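(* Let $k\in\{3,4,5\}$, let $b_j^{(k)}$ be the BDF-$k$ kernels, and let $v_0,v_1,\dots,v_N$ be a real sequence. Then there exist a positive constant $\sigma_{Lk}$ and nonnegative quadratic functionals $\mathcal{G}_k$, $\mathcal{R}_k$ such that $$v_n\sum_{j=1}^n b_{n-j}^{(k)}v_j=\mathcal{G}_k[\vec v_n]-\mathcal{G}_k[\vec v_{n-1}]+\frac{\sigma_{Lk}}{2}v_n^2+\mathcal{R}_k[\vec v_n]\qquad\text{for } k\le n\le N,$$ where $\sigma_{Lk}$, $\mathcal{G}_k$, $\mathcal{R}_k$ are given as follows. For $k=3$: $\sigma_{L3}=\frac{95}{48}$, $$\mathcal{G}_3[\vec v_n]=\tfrac{37}{96}v_n^2-\tfrac18v_{n-1}^2+\tfrac{7}{24}(\delta_1v_n)^2=\tfrac16v_n^2+\tfrac16\left(\tfrac74v_n-v_{n-1}\right)^2,$$ $$\mathcal{R}_3[\vec v_n]=\tfrac16\left(\delta_1^2v_n+\tfrac14v_{n-1}\right)^2.$$ For $k=4$: $\sigma_{L4}=\frac{4919}{3072}$, $$\mathcal{G}_4[\vec v_n]=\tfrac{3433}{6144}v_n^2-\tfrac{15}{64}v_{n-1}^2+\tfrac18v_{n-2}^2+\tfrac{47}{192}(\delta_1v_n)^2-\tfrac{3}{16}(\delta_1v_{n-1})^2+\tfrac{3}{16}(\delta_1^2v_n)^2$$ $$=\tfrac{13627}{43008}v_n^2+\tfrac{7}{24}\left(\tfrac{65}{56}v_n-v_{n-1}\right)^2+\tfrac18\left(\tfrac32\delta_1v_n+v_{n-2}\right)^2,$$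 $$\mathcal{R}_4[\vec v_n]=\tfrac18\left(\delta_1^3v_n+\tfrac32\delta_1v_{n-1}\right)^2+\tfrac16\left(\delta_1^2v_n+\tfrac{35}{32}v_{n-1}\right)^2.$$ For $k=5$: $\sigma_{L5}=\frac{646631}{1920000}$, $$\mathcal{G}_5[\vec v_n]=\tfrac{4227769}{3840000}v_n^2-\tfrac{551}{1600}v_{n-1}^2+\tfrac{17}{40}v_{n-2}^2-\tfrac1{10}v_{n-3}^2+\tfrac{1607}{4800}(\delta_1v_n)^2-\tfrac{39}{80}(\delta_1v_{n-1})^2$$ $$\quad+\tfrac25(\delta_1v_{n-2})^2+\tfrac7{80}(\delta_1^2v_n)^2-\tfrac25(\delta_1^2v_{n-1})^2+\tfrac15(\delta_1^3v_n)^2$$ $$=\tfrac{1198850903}{1678080000}v_n^2+\tfrac{437}{900}\left(\tfrac{4931}{6992}v_n-v_{n-1}\right)^2+\tfrac{9}{40}\left(\tfrac{23}{18}\delta_1v_n+v_{n-2}\right)^2+\tfrac1{10}\left(2\delta_1v_n+2v_{n-2}-v_{n-3}\right)^2,$$ $$\mathcal{R}_5[\vec v_n]=\tfrac1{10}\left(\delta_1^4v_n+2\delta_1^2v_{n-1}\right)^2+\tfrac18\left(\delta_1^3v_n+\tfrac{23}{10}\delta_1v_{n-1}\right)^2+\tfrac16\left(\delta_1^2v_n+\tfrac{1787}{800}v_{n-1}\right)^2.$$ Consequently, the quadratic form associated with the BDF-$k$ kernels satisfies $$2\sum_{\ell=k}^n v_\ell\sum_{j=k}^\ell b_{\ell-j}^{(k)}v_j\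 \ge\ \sigma_{Lk}\sum_{\ell=k}^n v_\ell^2\qquad\text{for } k\le n\le N.$$
   Context: The BDF-$k$ kernels $b_0^{(k)},\dots,b_{k-1}^{(k)}$ are the coefficients defined by $\sum_{\ell=1}^{k}\frac1\ell(1-\zeta)^{\ell-1}=\sum_{\ell=0}^{k-1}b_\ell^{(k)}\zeta^\ell$, and $b_j^{(k)}:=0$ for $j\ge k$. Explicitly, $(b_j^{(3)})_{j=0}^{2}=(\frac{11}6,-\frac76,\frac13)$, $(b_j^{(4)})_{j=0}^{3}=(\frac{25}{12},-\frac{23}{12},\frac{13}{12},-\frac14)$, $(b_j^{(5)})_{j=0}^{4}=(\frac{137}{60},-\frac{163}{60},\frac{137}{60},-\frac{21}{20},\frac15)$. The difference operators are $\delta_1v_n:=\delta_1^1v_n:=v_n-v_{n-1}$ and $\delta_1^{m+1}v_n:=\delta_1^mv_n-\delta_1^mv_{n-1}$ for $m\ge1$. The vector $\vec v_n:=(v_n,v_{n-1},\dots,v_0)$, and $\mathcal{G}_k[\vec v_{n-1}]$ is the expression of $\mathcal{G}_k[\vec v_n]$ with every index decreased by one. *)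

theory Defs
  imports Complex_Main "HOL-Computational_Algebra.Polynomial"
begin

text \<open>The polynomial has degree below \<open>k\<close>, so the convention \<open>b j = 0\<close> for \<open>j \<ge> k\<close>
  is automatic (lemma \<open>bdf_kernel_eq_0\<close>).\<close>

definition bdf_kernel :: "nat \<Rightarrow> nat \<Rightarrow> real" where
  "bdf_kernel k j = coeff (\<Sum>l=1..k. smult (1 / real l) ([:1, -1:] ^ (l - 1))) j"

lemma bdf_kernel_eq_0: "k \<le> j \<Longrightarrow> bdf_kernel k j = 0"
proof -
  assume kj: "k \<le> j"
  have "coeff (smult (1 / real l) ([:1, -1:] ^ (l - 1))) j = 0" if "l \<in> {1..k}" for l
  proof -
    have "degree ([:1, -1::real:] ^ (l - 1)) \<le> l - 1"
      by (rule order_trans[OF degree_power_le]) simp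
    with that kj have "degree ([:1, -1::real:] ^ (l - 1)) < j" by auto
    then show ?thesis by (simp add: coeff_eq_0)
  qed
  then show ?thesis by (simp add: bdf_kernel_def coeff_sum del: coeff_smult)
qed

lemma bdf_kernel_3:
  "map (bdf_kernel 3) [0..<3] = [11/6, -7/6, 1/3]"
  by (simp add: bdf_kernel_def numeral_eq_Suc upt_rec sum.atLeast_Suc_atMost)

lemma bdf_kernel_4:
  "map (bdf_kernel 4) [0..<4] = [25/12, -23/12, 13/12, -1/4]"
  by (simp add: bdf_kernel_def numeral_eq_Suc upt_rec sum.atLeast_Suc_atMost)

lemma bdf_kernel_5:
  "map (bdf_kernel 5) [0..<5] = [137/60, -163/60, 137/60, -21/20, 1/5]"
  by (simp add: bdf_kernel_def numeral_eq_Suc upt_rec sum.atLeast_Suc_atMost)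

text \<open>\<open>bdiff m v n\<close> is the \<open>m\<close>-th backward difference of \<open>v\<close> at \<open>n\<close>; \<open>m = 0\<close> is the identity.
  It is meaningful only for \<open>m \<le> n\<close>, because \<open>n - 1\<close> is truncated subtraction.\<close>

primrec bdiff :: "nat \<Rightarrow> (nat \<Rightarrow> real) \<Rightarrow> nat \<Rightarrow> real" where
  "bdiff 0 v n = v n"
| "bdiff (Suc m) v n = bdiff m v n - bdiff m v (n - 1)"

text \<open>The vector \<open>(v n, v (n - 1), \<dots>, v 0)\<close>, latest entry first.\<close>

definition hist :: "(nat \<Rightarrow> real) \<Rightarrow> nat \<Rightarrow> real list" where
  "hist v n = map v (rev [0..<Suc n])"

text \<open>A quadratic form in the first \<open>m + 1\<close> entries of its argument, i.e. in
  \<open>v n, \<dots>, v (n - m)\<close> when applied to \<open>hist v n\<close>. The coefficients do not depend on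
  the length of the vector, so applying the functional to \<open>hist v (n - 1)\<close> amounts to
  decreasing every index by one. Shorter vectors are outside the intended domain and
  the value there is left unspecified.\<close>

definition quadratic_functional :: "nat \<Rightarrow> (real list \<Rightarrow> real) \<Rightarrow> bool" where
  "quadratic_functional m Q \<longleftrightarrow>
     (\<exists>a :: nat \<Rightarrow> nat \<Rightarrow> real. \<forall>xs. m < length xs \<longrightarrow>
        Q xs = (\<Sum>i\<le>m. \<Sum>j\<le>m. a i j * xs ! i * xs ! j))"

definition nonneg_quadratic_functional :: "nat \<Rightarrow> (real list \<Rightarrow> real) \<Rightarrow> bool" where
  "nonneg_quadratic_functional m Q \<longleftrightarrow>
     quadratic_functional m Q \<and> (\<forall>xs. m < length xs \<longrightarrow> 0 \<le> Q xs)"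

end

theory Submission
  imports Defs
begin

text \<open>
  The generating polynomial of the kernel turns the convolution at \<open>n\<close> into the sum over
  \<open>l = 1, \<dots>, k\<close> of the backward differences of order \<open>l - 1\<close> with weights \<open>1 / l\<close>. Its product with
  \<open>v n\<close> splits, as in \<open>2 * a * (a - b) = a^2 - b^2 + (a - b)^2\<close>, into an increment of an energy
  and squares: for each \<open>l \<ge> 3\<close>, the functional \<open>R\<close> contains a square of weight \<open>1 / (2 * l)\<close> led by
  the difference of order \<open>l - 1\<close>.

  Once the coefficients are known, the energy identity for each \<open>k\<close> is an equality between two
  quadratic polynomials in the \<open>k\<close> real variables \<open>v n, \<dots>, v (n - k + 1)\<close>, because the kernel
  vanishes from index \<open>k\<close> on (\<open>bdf_convolution\<close>), and it is verified by expansion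
  (\<open>bdf3_energy_identity\<close>, \<open>bdf4_energy_identity\<close>, \<open>bdf5_energy_identity\<close>). The functionals
  \<open>G\<close> and \<open>R\<close> are taken as sums of squares of linear functionals with positive weights
  (\<open>energy3\<close>, \<open>dissipation3\<close> and their analogues), which makes their nonnegativity evident; the
  mixed-sign expression for \<open>G\<close> is a second expansion of the same quadratic form.

  The lower bound on the quadratic form is a consequence of the identity alone
  (\<open>kernel_form_lower_bound\<close>): a sequence that vanishes before index \<open>k\<close> has zero initial
  energy, so summing the identity telescopes to the sum of the final energy, the accumulated \<open>R\<close> and
  \<open>\<sigma> / 2\<close> times the sum of squares, where the first two are nonnegative.
\<close>

section \<open>Linear and quadratic functionals of a history vector\<close>

definition linear_functional :: "nat \<Rightarrow> (real list \<Rightarrow> real) \<Rightarrow> bool" where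
  "linear_functional m L \<longleftrightarrow> (\<exists>c :: nat \<Rightarrow> real. \<forall>xs. L xs = (\<Sum>i\<le>m. c i * xs ! i))"

lemma linear_functional_nth:
  assumes "i \<le> m"
  shows "linear_functional m (\<lambda>xs. xs ! i)"
  unfolding linear_functional_def
proof (intro exI allI)
  fix xs :: "real list"
  have "(\<Sum>j\<le>m. (if j = i then 1 else 0) * xs ! j) = (\<Sum>j\<le>m. if j = i then xs ! j else 0)"
    by (intro sum.cong) auto
  also have "\<dots> = xs ! i"
    using assms by simp
  finally show "xs ! i = (\<Sum>j\<le>m. (if j = i then 1 else 0) * xs ! j)" ..
qed

lemma linear_functional_add:
  assumes "linear_functional m K" and "linear_functional m L"
  shows "linear_functional m (\<lambda>xs. K xs + L xs)"
proof -
  from assms obtain c d where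
    "\<forall>xs. K xs = (\<Sum>i\<le>m. c i * xs ! i)" "\<forall>xs. L xs = (\<Sum>i\<le>m. d i * xs ! i)"
    unfolding linear_functional_def by blast
  then have "\<forall>xs. K xs + L xs = (\<Sum>i\<le>m. (c i + d i) * xs ! i)"
    by (simp add: distrib_right sum.distrib)
  then show ?thesis
    unfolding linear_functional_def by (rule exI[where x = "\<lambda>i. c i + d i"])
qed

lemma linear_functional_cmult:
  assumes "linear_functional m L"
  shows "linear_functional m (\<lambda>xs. a * L xs)"
proof -
  from assms obtain c where "\<forall>xs. L xs = (\<Sum>i\<le>m. c i * xs ! i)"
    unfolding linear_functional_def by blast
  then have "\<forall>xs. a * L xs = (\<Sum>i\<le>m. (a * c i) * xs ! i)"
    by (simp add: sum_distrib_left mult.assoc)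
  then show ?thesis
    unfolding linear_functional_def by (rule exI[where x = "\<lambda>i. a * c i"])
qed

lemma linear_functional_diff:
  assumes "linear_functional m K" and "linear_functional m L"
  shows "linear_functional m (\<lambda>xs. K xs - L xs)"
  using linear_functional_add[OF assms(1) linear_functional_cmult[OF assms(2), of "-1"]]
  by simp

lemma nonneg_quadratic_functional_square:
  assumes "linear_functional m L" and "0 \<le> w"
  shows "nonneg_quadratic_functional m (\<lambda>xs. w * (L xs)^2)"
proof -
  from assms obtain c where c: "\<forall>xs. L xs = (\<Sum>i\<le>m. c i * xs ! i)"
    unfolding linear_functional_def by blast
  have "w * (L xs)^2 = (\<Sum>i\<le>m. \<Sum>j\<le>m. (w * c i * c j) * xs ! i * xs ! j)" for xs
    using c by (simp add: power2_eq_square sum_product sum_distrib_left mult_ac)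
  then have "quadratic_functional m (\<lambda>xs. w * (L xs)^2)"
    unfolding quadratic_functional_def by (intro exI[where x = "\<lambda>i j. w * c i * c j"]) simp
  with assms(2) show ?thesis
    by (simp add: nonneg_quadratic_functional_def)
qed

lemma nonneg_quadratic_functional_add:
  assumes "nonneg_quadratic_functional m P" and "nonneg_quadratic_functional m Q"
  shows "nonneg_quadratic_functional m (\<lambda>xs. P xs + Q xs)"
proof -
  from assms obtain a b where
    "\<forall>xs. m < length xs \<longrightarrow> P xs = (\<Sum>i\<le>m. \<Sum>j\<le>m. a i j * xs ! i * xs ! j)"
    "\<forall>xs. m < length xs \<longrightarrow> Q xs = (\<Sum>i\<le>m. \<Sum>j\<le>m. b i j * xs ! i * xs ! j)"
    unfolding nonneg_quadratic_functional_def quadratic_functional_def by blast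
  then have "quadratic_functional m (\<lambda>xs. P xs + Q xs)"
    unfolding quadratic_functional_def
    by (intro exI[where x = "\<lambda>i j. a i j + b i j"]) (simp add: distrib_right sum.distrib)
  with assms show ?thesis
    by (simp add: nonneg_quadratic_functional_def)
qed

lemma length_hist: "length (hist v n) = Suc n"
  by (simp add: hist_def)

lemma hist_nth: "i \<le> n \<Longrightarrow> hist v n ! i = v (n - i)"
  by (simp add: hist_def rev_nth del: upt_Suc)

lemma quadratic_functional_hist_eq_0:
  assumes "quadratic_functional m Q" and "m \<le> n" and "\<And>i. i \<le> n \<Longrightarrow> v i = 0"
  shows "Q (hist v n) = 0"
proof -
  have "hist v n ! i = 0" if "i \<le> m" for i
    using that assms(2,3) by (simp add: hist_nth)
  then show ?thesis
    using assms(1,2) by (auto simp: quadratic_functional_def length_hist)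
qed

text \<open>The difference operator acting on a vector whose latest entry comes first: the index
  counts steps into the past, so the backward difference subtracts the entry with the next
  higher index.\<close>

primrec past_diff :: "nat \<Rightarrow> nat \<Rightarrow> real list \<Rightarrow> real" where
  "past_diff 0 i xs = xs ! i"
| "past_diff (Suc m) i xs = past_diff m i xs - past_diff m (Suc i) xs"

lemma past_diff_hist:
  "m + i \<le> n \<Longrightarrow> past_diff m i (hist v n) = bdiff m v (n - i)"
  by (induction m arbitrary: i) (simp_all add: hist_nth)

lemma linear_functional_past_diff:
  "m + i \<le> r \<Longrightarrow> linear_functional r (past_diff m i)"
proof (induction m arbitrary: i)
  case 0
  then show ?case
    using linear_functional_nth[of i r] by simp
next
  case (Suc m)
  then show ?case
    using linear_functional_diff[of r "past_diff m i" "past_diff m (Suc i)"] by simp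
qed

lemmas nonneg_quadratic_functional_intros =
  nonneg_quadratic_functional_add nonneg_quadratic_functional_square
  linear_functional_add linear_functional_diff linear_functional_cmult
  linear_functional_nth linear_functional_past_diff

section \<open>From the energy identity to the lower bound\<close>

text \<open>The vanishing past is what makes this work for sums that start at \<open>k\<close>: replacing
  \<open>v\<close> by zero below \<open>k\<close> turns the convolution from \<open>1\<close> in the energy identity into
  the convolution from \<open>k\<close>, and at the same time removes the initial energy, which only depends
  on values at indices below \<open>k\<close>.\<close>

lemma kernel_form_lower_bound:
  fixes b :: "nat \<Rightarrow> real" and v :: "nat \<Rightarrow> real"
  assumes G: "nonneg_quadratic_functional p G" and R: "nonneg_quadratic_functional q R"
    and pq: "p < k" "q \<le> k"
    and identity: "\<And>w n. k \<le> n \<Longrightarrow> w n * (\<Sum>j=1..n. b (n - j) * w j)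
        = G (hist w n) - G (hist w (n - 1)) + \<sigma> / 2 * (w n)^2 + R (hist w n)"
    and "k \<le> n"
  shows "\<sigma> * (\<Sum>l=k..n. (v l)^2) \<le> 2 * (\<Sum>l=k..n. v l * (\<Sum>j=k..l. b (l - j) * v j))"
proof -
  define w where "w j = (if k \<le> j then v j else 0)" for j
  have increment: "v l * (\<Sum>j=k..l. b (l - j) * v j)
      = G (hist w l) - G (hist w (l - 1)) + \<sigma> / 2 * (v l)^2 + R (hist w l)" if "k \<le> l" for l
  proof -
    have "(\<Sum>j=1..l. b (l - j) * w j) = (\<Sum>j=k..l. b (l - j) * v j)"
      using pq(1) by (intro sum.mono_neutral_cong_right) (auto simp: w_def)
    with identity[OF that, of w] that show ?thesis
      by (simp add: w_def)
  qed
  have initial: "G (hist w (k - 1)) = 0"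
  proof (rule quadratic_functional_hist_eq_0)
    show "quadratic_functional p G"
      using G by (simp add: nonneg_quadratic_functional_def)
  qed (use pq(1) in \<open>auto simp: w_def\<close>)
  have R_nonneg: "0 \<le> R (hist w l)" if "k \<le> l" for l
    using R pq(2) that by (simp add: nonneg_quadratic_functional_def length_hist)
  have energy: "\<sigma> / 2 * (\<Sum>l=k..n. (v l)^2) + G (hist w n)
      \<le> (\<Sum>l=k..n. v l * (\<Sum>j=k..l. b (l - j) * v j))"
    using \<open>k \<le> n\<close>
  proof (induction n rule: dec_induct)
    case base
    then show ?case
      using increment[of k] R_nonneg[of k] initial by simp
  next
    case (step n)
    then show ?case
      using increment[of "Suc n"] R_nonneg[of "Suc n"]
      by (simp add: distrib_left)
  qed
  have "0 \<le> G (hist w n)"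
    using G pq(1) \<open>k \<le> n\<close> by (simp add: nonneg_quadratic_functional_def length_hist)
  with energy show ?thesis
    by simp
qed

section \<open>The energy identities of the three kernels\<close>

text \<open>Reversing the order of summation makes the sum run over a fixed number of past values. The
  kernel is read off from the coefficient list so that its explicit values can be substituted for
  the list as a whole.\<close>

lemma bdf_convolution:
  assumes "k \<le> n"
  shows "(\<Sum>j=1..n. bdf_kernel k (n - j) * v j)
    = (\<Sum>i<k. map (bdf_kernel k) [0..<k] ! i * v (n - i))"
proof -
  have "(\<Sum>j=1..n. bdf_kernel k (n - j) * v j) = (\<Sum>i<n. bdf_kernel k i * v (n - i))"
    by (rule sum.reindex_bij_witness[where i = "\<lambda>i. n - i" and j = "\<lambda>j. n - j"]) auto
  also have "\<dots> = (\<Sum>i<k. map (bdf_kernel k) [0..<k] ! i * v (n - i))"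
    using assms by (intro sum.mono_neutral_cong_right) (auto simp: bdf_kernel_eq_0)
  finally show ?thesis .
qed

definition energy3 :: "real list \<Rightarrow> real" where
  "energy3 xs = 1/6 * (xs ! 0)^2 + 1/6 * (7/4 * xs ! 0 - xs ! 1)^2"

definition dissipation3 :: "real list \<Rightarrow> real" where
  "dissipation3 xs = 1/6 * (past_diff 2 0 xs + 1/4 * xs ! 1)^2"

definition energy4 :: "real list \<Rightarrow> real" where
  "energy4 xs = 13627/43008 * (xs ! 0)^2 + 7/24 * (65/56 * xs ! 0 - xs ! 1)^2
     + 1/8 * (3/2 * past_diff 1 0 xs + xs ! 2)^2"

definition dissipation4 :: "real list \<Rightarrow> real" where
  "dissipation4 xs = 1/8 * (past_diff 3 0 xs + 3/2 * past_diff 1 1 xs)^2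
     + 1/6 * (past_diff 2 0 xs + 35/32 * xs ! 1)^2"

definition energy5 :: "real list \<Rightarrow> real" where
  "energy5 xs = 1198850903/1678080000 * (xs ! 0)^2
     + 437/900 * (4931/6992 * xs ! 0 - xs ! 1)^2
     + 9/40 * (23/18 * past_diff 1 0 xs + xs ! 2)^2
     + 1/10 * (2 * past_diff 1 0 xs + 2 * xs ! 2 - xs ! 3)^2"

definition dissipation5 :: "real list \<Rightarrow> real" where
  "dissipation5 xs = 1/10 * (past_diff 4 0 xs + 2 * past_diff 2 1 xs)^2
     + 1/8 * (past_diff 3 0 xs + 23/10 * past_diff 1 1 xs)^2
     + 1/6 * (past_diff 2 0 xs + 1787/800 * xs ! 1)^2"

lemma nonneg_quadratic_functional_energy:
  "nonneg_quadratic_functional 1 energy3"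
  "nonneg_quadratic_functional 2 energy4"
  "nonneg_quadratic_functional 3 energy5"
  unfolding energy3_def energy4_def energy5_def
  by (intro nonneg_quadratic_functional_intros; simp)+

lemma nonneg_quadratic_functional_dissipation:
  "nonneg_quadratic_functional 2 dissipation3"
  "nonneg_quadratic_functional 3 dissipation4"
  "nonneg_quadratic_functional 4 dissipation5"
  unfolding dissipation3_def dissipation4_def dissipation5_def
  by (intro nonneg_quadratic_functional_intros; simp)+

lemma energy3_hist:
  assumes "1 \<le> n"
  shows "energy3 (hist v n) = 1/6 * (v n)^2 + 1/6 * (7/4 * v n - v (n - 1))^2"
  using assms by (simp add: energy3_def hist_nth)

lemma energy4_hist:
  assumes "2 \<le> n"
  shows "energy4 (hist v n) = 13627/43008 * (v n)^2 + 7/24 * (65/56 * v n - v (n - 1))^2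
    + 1/8 * (3/2 * bdiff 1 v n + v (n - 2))^2"
  using assms by (simp add: energy4_def hist_nth past_diff_hist del: One_nat_def)

lemma energy5_hist:
  assumes "3 \<le> n"
  shows "energy5 (hist v n) = 1198850903/1678080000 * (v n)^2
    + 437/900 * (4931/6992 * v n - v (n - 1))^2
    + 9/40 * (23/18 * bdiff 1 v n + v (n - 2))^2
    + 1/10 * (2 * bdiff 1 v n + 2 * v (n - 2) - v (n - 3))^2"
  using assms by (simp add: energy5_def hist_nth past_diff_hist del: One_nat_def)

lemma dissipation3_hist:
  assumes "2 \<le> n"
  shows "dissipation3 (hist v n) = 1/6 * (bdiff 2 v n + 1/4 * v (n - 1))^2"
  using assms by (simp add: dissipation3_def hist_nth past_diff_hist del: One_nat_def)

lemma dissipation4_hist: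
  assumes "3 \<le> n"
  shows "dissipation4 (hist v n) = 1/8 * (bdiff 3 v n + 3/2 * bdiff 1 v (n - 1))^2
    + 1/6 * (bdiff 2 v n + 35/32 * v (n - 1))^2"
  using assms by (simp add: dissipation4_def hist_nth past_diff_hist del: One_nat_def)

lemma dissipation5_hist:
  assumes "4 \<le> n"
  shows "dissipation5 (hist v n) = 1/10 * (bdiff 4 v n + 2 * bdiff 2 v (n - 1))^2
    + 1/8 * (bdiff 3 v n + 23/10 * bdiff 1 v (n - 1))^2
    + 1/6 * (bdiff 2 v n + 1787/800 * v (n - 1))^2"
  using assms by (simp add: dissipation5_def hist_nth past_diff_hist del: One_nat_def)

text \<open>The low-order differences in terms of the sequence, with truncated subtractions merged so
  that equal indices agree syntactically.\<close>

lemma bdiff_expand: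
  "bdiff 1 v n = v n - v (n - 1)"
  "bdiff 2 v n = v n - 2 * v (n - 1) + v (n - 2)"
  "bdiff 3 v n = v n - 3 * v (n - 1) + 3 * v (n - 2) - v (n - 3)"
  "bdiff 4 v n = v n - 4 * v (n - 1) + 6 * v (n - 2) - 4 * v (n - 3) + v (n - 4)"
  by (simp_all add: numeral_eq_Suc)

lemma energy3_differences:
  assumes "1 \<le> n"
  shows "energy3 (hist v n)
    = 37/96 * (v n)^2 - 1/8 * (v (n - 1))^2 + 7/24 * (bdiff 1 v n)^2"
  by (simp only: energy3_hist[OF assms] bdiff_expand power2_eq_square diff_diff_left)
    (simp add: algebra_simps add_divide_distrib diff_divide_distrib numeral_eq_Suc)

lemma energy4_differences:
  assumes "2 \<le> n"
  shows "energy4 (hist v n)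
    = 3433/6144 * (v n)^2 - 15/64 * (v (n - 1))^2 + 1/8 * (v (n - 2))^2
      + 47/192 * (bdiff 1 v n)^2 - 3/16 * (bdiff 1 v (n - 1))^2 + 3/16 * (bdiff 2 v n)^2"
  by (simp only: energy4_hist[OF assms] bdiff_expand power2_eq_square diff_diff_left)
    (simp add: algebra_simps add_divide_distrib diff_divide_distrib numeral_eq_Suc)

lemma energy5_differences:
  assumes "3 \<le> n"
  shows "energy5 (hist v n)
    = 4227769/3840000 * (v n)^2 - 551/1600 * (v (n - 1))^2
      + 17/40 * (v (n - 2))^2 - 1/10 * (v (n - 3))^2
      + 1607/4800 * (bdiff 1 v n)^2 - 39/80 * (bdiff 1 v (n - 1))^2
      + 2/5 * (bdiff 1 v (n - 2))^2
      + 7/80 * (bdiff 2 v n)^2 - 2/5 * (bdiff 2 v (n - 1))^2 + 1/5 * (bdiff 3 v n)^2"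
  by (simp only: energy5_hist[OF assms] bdiff_expand power2_eq_square diff_diff_left)
    (simp add: algebra_simps add_divide_distrib diff_divide_distrib numeral_eq_Suc)

lemma bdf3_energy_identity:
  assumes "3 \<le> n"
  shows "v n * (\<Sum>j=1..n. bdf_kernel 3 (n - j) * v j)
    = energy3 (hist v n) - energy3 (hist v (n - 1)) + (95/48) / 2 * (v n)^2
      + dissipation3 (hist v n)"
proof -
  have "(\<Sum>j=1..n. bdf_kernel 3 (n - j) * v j) = 11/6 * v n - 7/6 * v (n - 1) + 1/3 * v (n - 2)"
    by (simp only: bdf_convolution[OF assms] bdf_kernel_3) (simp add: numeral_eq_Suc)
  moreover have "1 \<le> n" "1 \<le> n - 1" "2 \<le> n"
    using assms by auto
  ultimately show ?thesis
    by (simp only: energy3_hist dissipation3_hist bdiff_expand power2_eq_square diff_diff_left)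
      (simp add: algebra_simps add_divide_distrib diff_divide_distrib numeral_eq_Suc)
qed

lemma bdf4_energy_identity:
  assumes "4 \<le> n"
  shows "v n * (\<Sum>j=1..n. bdf_kernel 4 (n - j) * v j)
    = energy4 (hist v n) - energy4 (hist v (n - 1)) + (4919/3072) / 2 * (v n)^2
      + dissipation4 (hist v n)"
proof -
  have "(\<Sum>j=1..n. bdf_kernel 4 (n - j) * v j)
      = 25/12 * v n - 23/12 * v (n - 1) + 13/12 * v (n - 2) - 1/4 * v (n - 3)"
    by (simp only: bdf_convolution[OF assms] bdf_kernel_4) (simp add: numeral_eq_Suc)
  moreover have "2 \<le> n" "2 \<le> n - 1" "3 \<le> n"
    using assms by auto
  ultimately show ?thesis
    by (simp only: energy4_hist dissipation4_hist bdiff_expand power2_eq_square diff_diff_left)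
      (simp add: algebra_simps add_divide_distrib diff_divide_distrib numeral_eq_Suc)
qed

lemma bdf5_energy_identity:
  assumes "5 \<le> n"
  shows "v n * (\<Sum>j=1..n. bdf_kernel 5 (n - j) * v j)
    = energy5 (hist v n) - energy5 (hist v (n - 1)) + (646631/1920000) / 2 * (v n)^2
      + dissipation5 (hist v n)"
proof -
  have "(\<Sum>j=1..n. bdf_kernel 5 (n - j) * v j)
      = 137/60 * v n - 163/60 * v (n - 1) + 137/60 * v (n - 2) - 21/20 * v (n - 3)
        + 1/5 * v (n - 4)"
    by (simp only: bdf_convolution[OF assms] bdf_kernel_5) (simp add: numeral_eq_Suc)
  moreover have "3 \<le> n" "3 \<le> n - 1" "4 \<le> n"
    using assms by auto
  ultimately show ?thesis
    by (simp only: energy5_hist dissipation5_hist bdiff_expand power2_eq_square diff_diff_left)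
      (simp add: algebra_simps add_divide_distrib diff_divide_distrib numeral_eq_Suc)
qed

theorem lemma2p3:
  fixes k :: nat
  assumes "k \<in> {3, 4, 5}"
  shows "\<exists>(\<sigma> :: real) (G :: real list \<Rightarrow> real) (R :: real list \<Rightarrow> real).
    \<sigma> > 0 \<and>
    nonneg_quadratic_functional (k - 2) G \<and>
    nonneg_quadratic_functional (k - 1) R \<and>
    (k = 3 \<longrightarrow>
      \<sigma> = 95/48 \<and>
      (\<forall>(v :: nat \<Rightarrow> real) n. n \<ge> 1 \<longrightarrow>
        G (hist v n) = 37/96 * (v n)^2 - 1/8 * (v (n - 1))^2 + 7/24 * (bdiff 1 v n)^2 \<and>
        G (hist v n) = 1/6 * (v n)^2 + 1/6 * (7/4 * v n - v (n - 1))^2) \<and>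
      (\<forall>(v :: nat \<Rightarrow> real) n. n \<ge> 2 \<longrightarrow>
        R (hist v n) = 1/6 * (bdiff 2 v n + 1/4 * v (n - 1))^2)) \<and>
    (k = 4 \<longrightarrow>
      \<sigma> = 4919/3072 \<and>
      (\<forall>(v :: nat \<Rightarrow> real) n. n \<ge> 2 \<longrightarrow>
        G (hist v n) = 3433/6144 * (v n)^2 - 15/64 * (v (n - 1))^2 + 1/8 * (v (n - 2))^2
          + 47/192 * (bdiff 1 v n)^2 - 3/16 * (bdiff 1 v (n - 1))^2
          + 3/16 * (bdiff 2 v n)^2 \<and>
        G (hist v n) = 13627/43008 * (v n)^2 + 7/24 * (65/56 * v n - v (n - 1))^2
          + 1/8 * (3/2 * bdiff 1 v n + v (n - 2))^2) \<and>
      (\<forall>(v :: nat \<Rightarrow> real) n. n \<ge> 3 \<longrightarrow>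
        R (hist v n) = 1/8 * (bdiff 3 v n + 3/2 * bdiff 1 v (n - 1))^2
          + 1/6 * (bdiff 2 v n + 35/32 * v (n - 1))^2)) \<and>
    (k = 5 \<longrightarrow>
      \<sigma> = 646631/1920000 \<and>
      (\<forall>(v :: nat \<Rightarrow> real) n. n \<ge> 3 \<longrightarrow>
        G (hist v n) = 4227769/3840000 * (v n)^2 - 551/1600 * (v (n - 1))^2
          + 17/40 * (v (n - 2))^2 - 1/10 * (v (n - 3))^2
          + 1607/4800 * (bdiff 1 v n)^2 - 39/80 * (bdiff 1 v (n - 1))^2
          + 2/5 * (bdiff 1 v (n - 2))^2
          + 7/80 * (bdiff 2 v n)^2 - 2/5 * (bdiff 2 v (n - 1))^2
          + 1/5 * (bdiff 3 v n)^2 \<and>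
        G (hist v n) = 1198850903/1678080000 * (v n)^2
          + 437/900 * (4931/6992 * v n - v (n - 1))^2
          + 9/40 * (23/18 * bdiff 1 v n + v (n - 2))^2
          + 1/10 * (2 * bdiff 1 v n + 2 * v (n - 2) - v (n - 3))^2) \<and>
      (\<forall>(v :: nat \<Rightarrow> real) n. n \<ge> 4 \<longrightarrow>
        R (hist v n) = 1/10 * (bdiff 4 v n + 2 * bdiff 2 v (n - 1))^2
          + 1/8 * (bdiff 3 v n + 23/10 * bdiff 1 v (n - 1))^2
          + 1/6 * (bdiff 2 v n + 1787/800 * v (n - 1))^2)) \<and>
    (\<forall>(v :: nat \<Rightarrow> real) N n. k \<le> n \<and> n \<le> N \<longrightarrow>
      v n * (\<Sum>j=1..n. bdf_kernel k (n - j) * v j)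
        = G (hist v n) - G (hist v (n - 1)) + \<sigma> / 2 * (v n)^2 + R (hist v n)) \<and>
    (\<forall>(v :: nat \<Rightarrow> real) N n. k \<le> n \<and> n \<le> N \<longrightarrow>
      2 * (\<Sum>l=k..n. v l * (\<Sum>j=k..l. bdf_kernel k (l - j) * v j))
        \<ge> \<sigma> * (\<Sum>l=k..n. (v l)^2))"
proof -
  consider "k = 3" | "k = 4" | "k = 5"
    using assms by auto
  then show ?thesis
  proof cases
    case 1
    have bound: "95/48 * (\<Sum>l=3..n. (v l)^2)
        \<le> 2 * (\<Sum>l=3..n. v l * (\<Sum>j=3..l. bdf_kernel 3 (l - j) * v j))"
      if "3 \<le> n" for v :: "nat \<Rightarrow> real" and n
      by (rule kernel_form_lower_bound[OF nonneg_quadratic_functional_energy(1)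
            nonneg_quadratic_functional_dissipation(1) _ _ bdf3_energy_identity that]) simp_all
    (* The clauses for the other two values of k have a false premise; simp removes them. *)
    show ?thesis
      unfolding \<open>k = 3\<close>
      by (rule exI[where x = "95/48"], rule exI[where x = energy3],
          rule exI[where x = dissipation3], intro conjI allI impI; (elim conjE)?;
          ((rule energy3_differences energy3_hist dissipation3_hist bdf3_energy_identity bound;
            assumption) |
           simp add: nonneg_quadratic_functional_energy[unfolded One_nat_def]
             nonneg_quadratic_functional_dissipation))
  next
    case 2
    have bound: "4919/3072 * (\<Sum>l=4..n. (v l)^2)
        \<le> 2 * (\<Sum>l=4..n. v l * (\<Sum>j=4..l. bdf_kernel 4 (l - j) * v j))"
      if "4 \<le> n" for v :: "nat \<Rightarrow> real" and n
      by (rule kernel_form_lower_bound[OF nonneg_quadratic_functional_energy(2)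
            nonneg_quadratic_functional_dissipation(2) _ _ bdf4_energy_identity that]) simp_all
    show ?thesis
      unfolding \<open>k = 4\<close>
      by (rule exI[where x = "4919/3072"], rule exI[where x = energy4],
          rule exI[where x = dissipation4], intro conjI allI impI; (elim conjE)?;
          ((rule energy4_differences energy4_hist dissipation4_hist bdf4_energy_identity bound;
            assumption) |
           simp add: nonneg_quadratic_functional_energy[unfolded One_nat_def]
             nonneg_quadratic_functional_dissipation))
  next
    case 3
    have bound: "646631/1920000 * (\<Sum>l=5..n. (v l)^2)
        \<le> 2 * (\<Sum>l=5..n. v l * (\<Sum>j=5..l. bdf_kernel 5 (l - j) * v j))"
      if "5 \<le> n" for v :: "nat \<Rightarrow> real" and n
      by (rule kernel_form_lower_bound[OF nonneg_quadratic_functional_energy(3)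
            nonneg_quadratic_functional_dissipation(3) _ _ bdf5_energy_identity that]) simp_all
    show ?thesis
      unfolding \<open>k = 5\<close>
      by (rule exI[where x = "646631/1920000"], rule exI[where x = energy5],
          rule exI[where x = dissipation5], intro conjI allI impI; (elim conjE)?;
          ((rule energy5_differences energy5_hist dissipation5_hist bdf5_energy_identity bound;
            assumption) |
           simp add: nonneg_quadratic_functional_energy[unfolded One_nat_def]
             nonneg_quadratic_functional_dissipation))
  qed
qed

end
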